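(* Let $\mathbb{F}$ be a finite field and let $\mathcal{C},\mathcal{C}'\subseteq\mathbb{F}((z))^n$ be two convolutional codes with positive overall constraint length. If $\mathcal{C}$ and $\mathcal{C}'$ are monomially equivalent, then $\bar{\Lambda}(\mathcal{C})=\bar{\Lambda}(\mathcal{C}')$, where $\bar{\Lambda}$ denotes the generalized adjacency matrix.
   Context: Let $\mathbb{F}$ be a finite field with $q$ elements. **Codes.** A matrix $G\in\mathbb{F}[z]^{k\times n}$ is *basic* if it has a right inverse in $\mathbb{F}[z]^{n\times k}$. A *convolutional code* of dimension $k$ is a subspace $\mathcal{C}=\operatorname{im}G=\{uG\mid u\in\mathbb{F}((z))^k\}$ of $\mathbb{F}((z))^n$ with $G\in\mathbb{F}[z]^{k\times n}$ basic; such a $G$ is called a *generator matrix*. The *overall constraint length* of $\mathcal{C}$ is the maximal degree of the $k\times k$ minors of $G$; it depends only on $\mathcal{C}$. A generator matrix is *minimal* if the sum of its row degrees (the degree of a row being the maximal degree of its entries) equals the overall constraint length. Every code has a minimal generator matrix. **Controller canonical form.** Let $G=(g_{ij})\in\mathbb{F}[z]^{k\times n}$ be a minimal generator matrix with row degrees $\gamma_1,\dots,\gamma_k$, $\gamma=\sum_i\gamma_i$, and $g_{ij}=\sum_{\nu=0}^{\gamma_i}g_{ij}^{(\nu)}z^\nu$. For each $i$ let $A_i\in\mathbb{F}^{\gamma_i\times\gamma_i}$ have ones on the first superdiagonal and zeros elsewhere, $B_i=(1,0,\dots,0)\in\mathbb{F}^{1\times\gamma_i}$, and let $C_i\in\mathbb{F}^{\gamma_i\times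 n}$ have $\nu$-th row $(g_{i1}^{(\nu)},\dots,g_{in}^{(\nu)})$, $\nu=1,\dots,\gamma_i$. Put $A=\operatorname{diag}(A_1,\dots,A_k)\in\mathbb{F}^{\gamma\times\gamma}$, $B=\operatorname{diag}(B_1,\dots,B_k)\in\mathbb{F}^{k\times\gamma}$ (block diagonal), let $C\in\mathbb{F}^{\gamma\times n}$ be $C_1,\dots,C_k$ stacked, and $D=(g_{ij}^{(0)})\in\mathbb{F}^{k\times n}$. If $\gamma_i=0$, the corresponding blocks are missing and the $i$-th row of $B$ is zero. **Adjacency matrix.** Let $s=q^\gamma$ and order the state space $\mathbb{F}^\gamma=\{X_0,\dots,X_{s-1}\}$ (row vectors) with $X_0=0$. With $\operatorname{wt}$ the Hamming weight on $\mathbb{F}^n$, for $i,j\in\{0,\dots,s-1\}$ and $\alpha\in\{0,\dots,n\}$ put $\lambda_{i,j}^{(\alpha)}=\#\{u\in\mathbb{F}^k\mid X_j=X_iA+uB,\ \operatorname{wt}(X_iC+uD)=\alpha\}$, except that $\lambda_{0,0}^{(0)}:=0$. The adjacency matrix of $G$ is $\Lambda_G=\big(\sum_{\alpha=0}^n\lambda_{i,j}^{(\alpha)}W^\alpha\big)_{i,j=0,\dots,s-1}\in\mathbb{Q}[W]^{s\times s}$. **Generalized adjacency matrix.** Let $\mathcal{G}$ be the group of permutation matrices $\Pi\in GL_s(\mathbb{Q})$ with $\Pi_{0,0}=1$ (indices running from $0$ to $s-1$). For $\Lambda\in\mathbb{Q}[W]^{s\times s}$ put $\overline{\Lambda}=\{\Pi\Lambda\Pi^{-1}\mid\Pi\in\mathcal{G}\}$.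 The generalized adjacency matrix of $\mathcal{C}$ is $\bar{\Lambda}(\mathcal{C}):=\overline{\Lambda_G}$ for any minimal generator matrix $G$ of $\mathcal{C}$ and any ordering of states with $X_0=0$; it does not depend on these choices. **Monomial equivalence.** Two matrices $G,G'\in\mathbb{F}[z]^{k\times n}$ are monomially equivalent if $G'=GPR$ for some permutation matrix $P\in GL_n(\mathbb{F})$ and some non-singular diagonal matrix $R\in GL_n(\mathbb{F})$. Two codes are monomially equivalent if they have monomially equivalent generator matrices. *)

theory Defs
  imports
    "Jordan_Normal_Form.Determinant"
    "Jordan_Normal_Form.DL_Submatrix"
    "HOL-Computational_Algebra.Formal_Laurent_Series"
    "HOL-Computational_Algebra.Polynomial_FPS"
begin

text \<open>Coding theory works with row vectors; \<open>u \<bullet>\<^sub>r M\<close> is the row vector \<open>u M\<close>.\<close>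

definition row_vec_mult :: "'a::comm_semiring_0 vec \<Rightarrow> 'a mat \<Rightarrow> 'a vec" (infixl "\<bullet>\<^sub>r" 70) where
  "u \<bullet>\<^sub>r M = transpose_mat M *\<^sub>v u"

definition const_poly_mat :: "'a::zero mat \<Rightarrow> 'a poly mat" where
  "const_poly_mat = map_mat (\<lambda>c. [:c:])"

definition permutation_mat :: "nat \<Rightarrow> 'a::{zero,one} mat \<Rightarrow> bool" where
  "permutation_mat n P \<longleftrightarrow>
     (\<exists>\<sigma>. \<sigma> permutes {..<n} \<and> P = mat n n (\<lambda>(i, j). if i = \<sigma> j then 1 else 0))"


section \<open>Convolutional codes\<close>

definition laurent_mat :: "'a::field poly mat \<Rightarrow> 'a fls mat" where
  "laurent_mat = map_mat (\<lambda>p. fps_to_fls (fps_of_poly p))"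

definition basic_mat :: "'a::field poly mat \<Rightarrow> bool" where
  "basic_mat G \<longleftrightarrow> (\<exists>H \<in> carrier_mat (dim_col G) (dim_row G). G * H = 1\<^sub>m (dim_row G))"

definition code_image :: "'a::field poly mat \<Rightarrow> 'a fls vec set" where
  "code_image G = {u \<bullet>\<^sub>r laurent_mat G | u. u \<in> carrier_vec (dim_row G)}"

text \<open>The length of the code is determined by the code, since all its words have dimension
  \<^term>\<open>dim_col G\<close> and there is at least the zero word.\<close>

definition generator_matrix :: "'a::field fls vec set \<Rightarrow> 'a poly mat \<Rightarrow> bool" where
  "generator_matrix C G \<longleftrightarrow> basic_mat G \<and> C = code_image G"

definition convolutional_code :: "nat \<Rightarrow> 'a::field fls vec set \<Rightarrow> bool" where
  "convolutional_code n C \<longleftrightarrow> (\<exists>G. generator_matrix C G \<and> dim_col G = n)"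

text \<open>The full-size minors are indexed by the sets \<open>J\<close> of selected columns. For a basic matrix
  they do not all vanish, so the convention \<open>degree 0 = 0\<close> does not affect the maximum.\<close>

definition max_minor_degree :: "'a::field poly mat \<Rightarrow> nat" where
  "max_minor_degree G =
     Max {degree (det (submatrix G UNIV J)) | J. J \<subseteq> {..<dim_col G} \<and> card J = dim_row G}"

text \<open>This number does not depend on the generator matrix chosen.\<close>

definition overall_constraint_length :: "'a::field fls vec set \<Rightarrow> nat" where
  "overall_constraint_length C = max_minor_degree (SOME G. generator_matrix C G)"

definition row_degree :: "'a::zero poly mat \<Rightarrow> nat \<Rightarrow> nat" where
  "row_degree G i = Max {degree (G $$ (i, j)) | j. j < dim_col G}"

definition total_row_degree :: "'a::zero poly mat \<Rightarrow> nat" where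
  "total_row_degree G = (\<Sum>i<dim_row G. row_degree G i)"

definition minimal_generator_matrix :: "'a::field fls vec set \<Rightarrow> 'a poly mat \<Rightarrow> bool" where
  "minimal_generator_matrix C G \<longleftrightarrow>
     generator_matrix C G \<and> total_row_degree G = overall_constraint_length C"


section \<open>Controller canonical form\<close>

text \<open>Indices start at 0. A row of degree 0 contributes an empty block to each of \<open>A\<close> and \<open>C\<close>
  and a \<open>1 \<times> 0\<close> block, i.e. a zero row, to \<open>B\<close>.\<close>

definition ccf_A :: "'a::field poly mat \<Rightarrow> 'a mat" where
  "ccf_A G = diag_block_mat (map (\<lambda>i.
     mat (row_degree G i) (row_degree G i) (\<lambda>(r, c). if c = r + 1 then 1 else 0)) [0..<dim_row G])"

definition ccf_B :: "'a::field poly mat \<Rightarrow> 'a mat" where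
  "ccf_B G = diag_block_mat (map (\<lambda>i.
     mat 1 (row_degree G i) (\<lambda>(r, c). if c = 0 then 1 else 0)) [0..<dim_row G])"

definition ccf_C :: "'a::field poly mat \<Rightarrow> 'a mat" where
  "ccf_C G = foldr append_rows (map (\<lambda>i.
     mat (row_degree G i) (dim_col G) (\<lambda>(r, c). coeff (G $$ (i, c)) (r + 1))) [0..<dim_row G])
     (0\<^sub>m 0 (dim_col G))"

definition ccf_D :: "'a::field poly mat \<Rightarrow> 'a mat" where
  "ccf_D G = map_mat (\<lambda>p. coeff p 0) G"


section \<open>Adjacency matrices\<close>

definition hamming_weight :: "'a::zero vec \<Rightarrow> nat" where
  "hamming_weight v = card {j. j < dim_vec v \<and> v $ j \<noteq> 0}"

definition num_states :: "'a::{field,finite} poly mat \<Rightarrow> nat" where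
  "num_states G = card (UNIV :: 'a set) ^ total_row_degree G"

definition state_ordering :: "'a::{field,finite} poly mat \<Rightarrow> (nat \<Rightarrow> 'a vec) \<Rightarrow> bool" where
  "state_ordering G X \<longleftrightarrow>
     bij_betw X {..<num_states G} (carrier_vec (total_row_degree G)) \<and> X 0 = 0\<^sub>v (total_row_degree G)"

definition transition_count ::
  "'a::{field,finite} poly mat \<Rightarrow> (nat \<Rightarrow> 'a vec) \<Rightarrow> nat \<Rightarrow> nat \<Rightarrow> nat \<Rightarrow> nat" where
  "transition_count G X i j \<alpha> =
     (if i = 0 \<and> j = 0 \<and> \<alpha> = 0 then 0
      else card {u \<in> carrier_vec (dim_row G).
             X j = X i \<bullet>\<^sub>r ccf_A G + u \<bullet>\<^sub>r ccf_B G \<and>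
             hamming_weight (X i \<bullet>\<^sub>r ccf_C G + u \<bullet>\<^sub>r ccf_D G) = \<alpha>})"

definition adjacency_matrix ::
  "'a::{field,finite} poly mat \<Rightarrow> (nat \<Rightarrow> 'a vec) \<Rightarrow> rat poly mat" where
  "adjacency_matrix G X = mat (num_states G) (num_states G)
     (\<lambda>(i, j). \<Sum>\<alpha>\<le>dim_col G. monom (of_nat (transition_count G X i j \<alpha>)) \<alpha>)"

definition state_permutation_mat :: "nat \<Rightarrow> rat mat \<Rightarrow> bool" where
  "state_permutation_mat s P \<longleftrightarrow> permutation_mat s P \<and> P $$ (0, 0) = 1"

text \<open>In the next definition \<open>Q\<close> is the inverse of \<open>P\<close>.\<close>

definition permutation_orbit :: "rat poly mat \<Rightarrow> rat poly mat set" where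
  "permutation_orbit L =
     {const_poly_mat P * L * const_poly_mat Q | P Q.
        state_permutation_mat (dim_row L) P \<and> inverts_mat P Q \<and> inverts_mat Q P}"

text \<open>The result does not depend on the minimal generator matrix and the state ordering chosen.\<close>

definition generalized_adjacency_matrix :: "'a::{field,finite} fls vec set \<Rightarrow> rat poly mat set" where
  "generalized_adjacency_matrix C = (SOME M. \<exists>G X.
     minimal_generator_matrix C G \<and> state_ordering G X \<and>
     M = permutation_orbit (adjacency_matrix G X))"


section \<open>Monomial equivalence\<close>

definition monomially_equivalent_mats :: "'a::field poly mat \<Rightarrow> 'a poly mat \<Rightarrow> bool" where
  "monomially_equivalent_mats G G' \<longleftrightarrow> (\<exists>P R.
     permutation_mat (dim_col G) P \<and>
     R \<in> carrier_mat (dim_col G) (dim_col G) \<and> diagonal_mat R \<and> invertible_mat R \<and>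
     G' = G * const_poly_mat P * const_poly_mat R)"

definition monomially_equivalent_codes :: "'a::field fls vec set \<Rightarrow> 'a fls vec set \<Rightarrow> bool" where
  "monomially_equivalent_codes C C' \<longleftrightarrow> (\<exists>G G'.
     generator_matrix C G \<and> generator_matrix C' G' \<and> monomially_equivalent_mats G G')"

end

theory Submission
  imports Defs
begin

text \<open>Right multiplication by a monomial matrix \<open>M\<close> maps the generator matrices of a code to
  those of the equivalent code and preserves row degrees. In the controller canonical form it leaves
  \<open>A\<close> and \<open>B\<close> alone and turns \<open>C\<close>, \<open>D\<close> into \<open>C M\<close>, \<open>D M\<close>; outputs change only by the
  weight-preserving map \<open>M\<close>, so the adjacency matrices agree literally. Minimality is preserved
  because the maximal minor degree is invariant under \<open>M\<close> and under a change of generator matrix,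
  the latter being left multiplication by a unimodular matrix. Hence both codes yield the same
  candidates for the generalized adjacency matrix.\<close>

section \<open>Matrices over polynomials and Laurent series\<close>

text \<open>The homomorphism part moves matrix products from polynomials to Laurent series;
  injectivity brings identities of matrices back.\<close>

interpretation laurent_hom: inj_comm_ring_hom "\<lambda>p :: 'a::field poly. fps_to_fls (fps_of_poly p)"
  by unfold_locales
    (simp_all add: fps_of_poly_add fps_of_poly_mult fls_times_fps_to_fls
      fps_of_poly_eq_iff[of _ 0, unfolded fps_of_poly_0])

lemma const_poly_hom: "comm_ring_hom (\<lambda>c :: 'a::comm_ring_1. [:c:])"
  by unfold_locales simp_all

lemma laurent_mat_carrier [simp]: "laurent_mat G \<in> carrier_mat m n \<longleftrightarrow> G \<in> carrier_mat m n"
  by (simp add: laurent_mat_def)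

lemma laurent_mat_mult:
  "A \<in> carrier_mat m k \<Longrightarrow> B \<in> carrier_mat k n \<Longrightarrow>
   laurent_mat (A * B) = laurent_mat A * laurent_mat B"
  unfolding laurent_mat_def by (rule laurent_hom.mat_hom_mult)

lemma laurent_mat_inject: "laurent_mat A = laurent_mat B \<Longrightarrow> A = B"
  unfolding laurent_mat_def by (rule laurent_hom.mat_hom_inj)

lemma laurent_mat_dim [simp]:
  "dim_row (laurent_mat G) = dim_row G" "dim_col (laurent_mat G) = dim_col G"
  by (simp_all add: laurent_mat_def)

lemma const_poly_mat_dim [simp]:
  "dim_row (const_poly_mat G) = dim_row G" "dim_col (const_poly_mat G) = dim_col G"
  by (simp_all add: const_poly_mat_def)

lemma const_poly_mat_carrier [simp]:
  "const_poly_mat G \<in> carrier_mat m n \<longleftrightarrow> G \<in> carrier_mat m n"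
  by (simp add: const_poly_mat_def)

text \<open>The determinant commutes with the embedding of constants, so it is again a constant,
  possibly zero.\<close>

lemma degree_det_const_poly_mat: "degree (det (const_poly_mat (N :: 'a::comm_ring_1 mat))) = 0"
  unfolding const_poly_mat_def comm_ring_hom.hom_det[OF const_poly_hom] by (rule degree_pCons_0)

lemma const_poly_mat_mult:
  fixes A B :: "'a::comm_ring_1 mat"
  assumes "A \<in> carrier_mat m k" "B \<in> carrier_mat k n"
  shows "const_poly_mat (A * B) = const_poly_mat A * const_poly_mat B"
  unfolding const_poly_mat_def
  by (rule semiring_hom.mat_hom_mult[OF comm_ring_hom.axioms(1)[OF const_poly_hom, THEN ring_hom.axioms(1)] assms])

lemma const_poly_mat_one: "const_poly_mat (1\<^sub>m n :: 'a::comm_ring_1 mat) = 1\<^sub>m n"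
  unfolding const_poly_mat_def
  by (rule semiring_hom.mat_hom_one[OF comm_ring_hom.axioms(1)[OF const_poly_hom, THEN ring_hom.axioms(1)]])

section \<open>Entries of matrix products and row vectors\<close>

lemma mult_mat_index_sum:
  assumes "A \<in> carrier_mat m k" "B \<in> carrier_mat k n" "i < m" "j < n"
  shows "(A * B) $$ (i, j) = (\<Sum>l = 0..<k. A $$ (i, l) * B $$ (l, j))"
proof -
  have "(A * B) $$ (i, j) = row A i \<bullet> col B j"
    using assms by simp
  also have "\<dots> = (\<Sum>l = 0..<k. row A i $ l * col B j $ l)"
    using assms(2) unfolding scalar_prod_def by simp
  also have "\<dots> = (\<Sum>l = 0..<k. A $$ (i, l) * B $$ (l, j))"
    using assms by (intro sum.cong) auto
  finally show ?thesis .
qed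

lemma row_vec_mult_carrier [simp]: "A \<in> carrier_mat m n \<Longrightarrow> u \<bullet>\<^sub>r A \<in> carrier_vec n"
  by (rule carrier_vecI) (auto simp: row_vec_mult_def)

lemma row_vec_mult_assoc:
  fixes A :: "'a::comm_semiring_0 mat"
  assumes "u \<in> carrier_vec m" "A \<in> carrier_mat m k" "B \<in> carrier_mat k n"
  shows "u \<bullet>\<^sub>r (A * B) = u \<bullet>\<^sub>r A \<bullet>\<^sub>r B"
  unfolding row_vec_mult_def transpose_mult[OF assms(2,3)]
  by (rule assoc_mult_mat_vec[where n\<^sub>2 = k]) (use assms in simp_all)

lemma row_vec_mult_add_left:
  fixes A :: "'a::comm_semiring_0 mat"
  assumes "A \<in> carrier_mat m n" "u \<in> carrier_vec m" "v \<in> carrier_vec m"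
  shows "(u + v) \<bullet>\<^sub>r A = u \<bullet>\<^sub>r A + v \<bullet>\<^sub>r A"
  using assms by (auto simp: row_vec_mult_def intro!: mult_add_distrib_mat_vec)

lemma unit_vec_row_vec_mult:
  fixes A :: "'a::comm_semiring_1 mat"
  assumes "A \<in> carrier_mat m n" "i < m"
  shows "unit_vec m i \<bullet>\<^sub>r A = row A i"
  using assms by (intro eq_vecI) (auto simp: row_vec_mult_def)

section \<open>Column selections and full-size minors\<close>

lemma card_lessThan_mem: "J \<subseteq> {..<n} \<Longrightarrow> {j. j < n \<and> j \<in> J} = J"
  by auto

lemma submatrix_cols_carrier:
  assumes "G \<in> carrier_mat k n" "J \<subseteq> {..<n}"
  shows "submatrix G UNIV J \<in> carrier_mat k (card J)"
  using assms by (auto simp: dim_submatrix card_lessThan_mem)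

lemma submatrix_cols_index:
  assumes "G \<in> carrier_mat k n" "J \<subseteq> {..<n}" "i < k" "j < card J"
  shows "submatrix G UNIV J $$ (i, j) = G $$ (i, pick J j)"
  using assms by (subst submatrix_index) (auto simp: card_lessThan_mem pick_UNIV)

lemma pick_lessThan: "J \<subseteq> {..<n} \<Longrightarrow> j < card J \<Longrightarrow> pick J j < n"
  by (meson lessThan_iff pick_in_set_le subsetD)

text \<open>A left factor acts on each column separately, so it commutes with selecting columns.
  Minors of \<open>T * G\<close> therefore acquire the factor \<open>det T\<close>.\<close>

lemma submatrix_cols_mult:
  assumes "T \<in> carrier_mat k k" "G \<in> carrier_mat k n" "J \<subseteq> {..<n}"
  shows "submatrix (T * G) UNIV J = T * submatrix G UNIV J"
proof -
  note c = submatrix_cols_carrier[OF assms(2,3)]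
    submatrix_cols_carrier[OF mult_carrier_mat[OF assms(1,2)] assms(3)]
  show ?thesis
  proof (rule eq_matI)
    fix i j assume "i < dim_row (T * submatrix G UNIV J)" "j < dim_col (T * submatrix G UNIV J)"
    hence ij: "i < k" "j < card J" using c assms(1) by auto
    have p: "pick J j < n" by (rule pick_lessThan[OF assms(3) ij(2)])
    have col: "col (submatrix G UNIV J) j = col G (pick J j)"
    proof (rule eq_vecI)
      fix l assume "l < dim_vec (col G (pick J j))"
      hence "l < k" using assms(2) by simp
      thus "col (submatrix G UNIV J) j $ l = col G (pick J j) $ l"
        using c(1) ij(2) p assms(2) submatrix_cols_index[OF assms(2,3) _ ij(2)] by simp
    qed (use c(1) assms(2) in simp)
    have "submatrix (T * G) UNIV J $$ (i, j) = (T * G) $$ (i, pick J j)"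
      by (rule submatrix_cols_index[OF mult_carrier_mat[OF assms(1,2)] assms(3) ij])
    also have "\<dots> = row T i \<bullet> col G (pick J j)"
      using ij p assms(1,2) by simp
    also have "\<dots> = (T * submatrix G UNIV J) $$ (i, j)"
      unfolding col[symmetric] using ij assms(1) c(1) by simp
    finally show "submatrix (T * G) UNIV J $$ (i, j) = (T * submatrix G UNIV J) $$ (i, j)" .
  qed (use c assms(1) in simp_all)
qed

text \<open>Each full-size minor is multiplied by \<open>det T\<close>, a unit of the polynomial
  ring and hence a nonzero constant.\<close>

lemma max_minor_degree_unimodular:
  fixes G :: "'a::field poly mat"
  assumes T: "T \<in> carrier_mat k k" "det T dvd 1" and G: "G \<in> carrier_mat k n"
  shows "max_minor_degree (T * G) = max_minor_degree G"
proof -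
  have "degree (det (submatrix (T * G) UNIV J)) = degree (det (submatrix G UNIV J))"
    if J: "J \<subseteq> {..<n}" "card J = k" for J
  proof -
    have S: "submatrix G UNIV J \<in> carrier_mat k k"
      using submatrix_cols_carrier[OF G J(1)] J(2) by simp
    have "det T \<noteq> 0" using T(2) by auto
    moreover from this have "degree (det T) = 0"
      using T(2) by (simp add: is_unit_iff_degree)
    \<comment> \<open>The zero polynomial is split off because degrees add only for nonzero
      factors.\<close>
    ultimately have "degree (det T * p) = degree p" for p
      by (cases "p = 0") (auto simp: degree_mult_eq)
    thus ?thesis
      unfolding submatrix_cols_mult[OF T(1) G J(1)] det_mult[OF T(1) S] .
  qed
  hence "{degree (det (submatrix (T * G) UNIV J)) | J. J \<subseteq> {..<n} \<and> card J = k} =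
         {degree (det (submatrix G UNIV J)) | J. J \<subseteq> {..<n} \<and> card J = k}"
    by auto metis+
  thus ?thesis using T G by (simp add: max_minor_degree_def)
qed

text \<open>If \<open>m < k\<close>, zero columns for \<open>S\<close> and zero rows for
  \<open>T\<close> make both matrices square without changing the product. Its determinant is then
  1, although the padded \<open>T\<close> has a zero row. The argument stays inside the integral
  domain, so it covers polynomial matrices.\<close>

lemma right_inverse_imp_dim_le:
  fixes S :: "'a::idom mat"
  assumes S: "S \<in> carrier_mat k m" and T: "T \<in> carrier_mat m k" and ST: "S * T = 1\<^sub>m k"
  shows "k \<le> m"
proof (rule ccontr)
  assume "\<not> k \<le> m"
  hence mk: "m < k" by simp
  define S' where "S' = mat k k (\<lambda>(i, j). if j < m then S $$ (i, j) else 0)"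
  define T' where "T' = mat k k (\<lambda>(i, j). if i < m then T $$ (i, j) else 0)"
  have c: "S' \<in> carrier_mat k k" "T' \<in> carrier_mat k k" by (auto simp: S'_def T'_def)
  have "S' * T' = S * T"
  proof (rule eq_matI)
    fix i j assume "i < dim_row (S * T)" "j < dim_col (S * T)"
    hence ij: "i < k" "j < k" using S T by auto
    have "(S' * T') $$ (i, j) = (\<Sum>l = 0..<k. S' $$ (i, l) * T' $$ (l, j))"
      by (rule mult_mat_index_sum[OF c ij])
    also have "\<dots> = (\<Sum>l = 0..<m. S' $$ (i, l) * T' $$ (l, j))"
      using mk ij by (intro sum.mono_neutral_right) (auto simp: S'_def)
    also have "\<dots> = (\<Sum>l = 0..<m. S $$ (i, l) * T $$ (l, j))"
      using mk ij by (intro sum.cong) (auto simp: S'_def T'_def)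
    also have "\<dots> = (S * T) $$ (i, j)"
      by (rule mult_mat_index_sum[OF S T ij, symmetric])
    finally show "(S' * T') $$ (i, j) = (S * T) $$ (i, j)" .
  qed (use S T c in auto)
  hence "det S' * det T' = 1"
    using det_mult[OF c] ST by simp
  moreover have "det T' = 0"
  proof -
    have "row T' m = 0\<^sub>v k" using mk by (intro eq_vecI) (auto simp: T'_def)
    \<comment> \<open>Scaling the zero row by 0 changes nothing, while it multiplies the determinant
      by 0.\<close>
    hence "det T' = det (multrow m 0 T')"
      using mk c by (intro arg_cong[where f = det] eq_matI) (auto simp: T'_def mat_multrow_def)
    thus ?thesis using det_multrow[OF mk c(2), of 0] by simp
  qed
  ultimately show False by simp
qed

section \<open>Change of generator matrix\<close>

lemma code_image_word_dim: "w \<in> code_image G \<Longrightarrow> dim_vec w = dim_col G"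
  by (auto simp: code_image_def row_vec_mult_def laurent_mat_def)

lemma zero_in_code_image: "0\<^sub>v (dim_row G) \<bullet>\<^sub>r laurent_mat G \<in> code_image G"
  by (auto simp: code_image_def)

text \<open>The zero word lies in both images, and its length is the number of columns of either
  matrix.\<close>

lemma code_image_dim_col: "code_image G = code_image G' \<Longrightarrow> dim_col G = dim_col G'"
  using zero_in_code_image code_image_word_dim by metis

lemma row_in_code_image:
  assumes "i < dim_row G"
  shows "row (laurent_mat G) i \<in> code_image G"
proof -
  have "unit_vec (dim_row G) i \<bullet>\<^sub>r laurent_mat G = row (laurent_mat G) i"
    using assms by (intro unit_vec_row_vec_mult) auto
  thus ?thesis unfolding code_image_def by (smt (verit) mem_Collect_eq unit_vec_carrier)
qed

text \<open>If \<open>G H = 1\<close>, then \<open>H G\<close> acts as the identity on every word of the code of \<open>G\<close>,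
  in particular on the rows of \<open>G'\<close>.\<close>

lemma code_image_subset_factor:
  assumes G: "G \<in> carrier_mat k n" and H: "H \<in> carrier_mat n k" and GH: "G * H = 1\<^sub>m k"
    and G': "G' \<in> carrier_mat k' n" and sub: "code_image G' \<subseteq> code_image G"
  shows "G' = G' * H * G"
proof -
  have K: "H * G \<in> carrier_mat n n" using G H by simp
  have GHG: "G * (H * G) = G"
    using G H GH by (simp flip: assoc_mult_mat)
  have fix_word: "w \<bullet>\<^sub>r laurent_mat (H * G) = w" if w: "w \<in> code_image G" for w
  proof -
    obtain u where u: "u \<in> carrier_vec k" "w = u \<bullet>\<^sub>r laurent_mat G"
      using w G by (auto simp: code_image_def)
    thus ?thesis
      using G K row_vec_mult_assoc[of u k "laurent_mat G" n "laurent_mat (H * G)" n]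
      by (simp add: GHG flip: laurent_mat_mult[OF G K])
  qed
  have "laurent_mat (G' * (H * G)) = laurent_mat G'"
  proof (rule eq_rowI)
    fix i assume "i < dim_row (laurent_mat G')"
    hence i: "i < k'" using G' by (simp add: laurent_mat_def)
    \<comment> \<open>Written as a unit vector times the matrix, the row becomes, by associativity,
      a word of the code multiplied by \<open>H * G\<close>.\<close>
    have "row (laurent_mat (G' * (H * G))) i = unit_vec k' i \<bullet>\<^sub>r laurent_mat (G' * (H * G))"
      using G' K i by (intro unit_vec_row_vec_mult[symmetric, where n = n]) auto
    also have "\<dots> = unit_vec k' i \<bullet>\<^sub>r laurent_mat G' \<bullet>\<^sub>r laurent_mat (H * G)"
      unfolding laurent_mat_mult[OF G' K] using G' K by (intro row_vec_mult_assoc[where k = n and n = n]) auto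
    also have "unit_vec k' i \<bullet>\<^sub>r laurent_mat G' = row (laurent_mat G') i"
      using G' i by (intro unit_vec_row_vec_mult[where n = n]) auto
    also have "\<dots> \<bullet>\<^sub>r laurent_mat (H * G) = \<dots>"
      using row_in_code_image[of i G'] i G' sub by (intro fix_word) auto
    finally show "row (laurent_mat (G' * (H * G))) i = row (laurent_mat G') i" .
  qed (use G' G H in \<open>auto simp: laurent_mat_def\<close>)
  hence "G' * (H * G) = G'" by (rule laurent_mat_inject)
  thus ?thesis using G G' H by (simp add: assoc_mult_mat[of G' k' n H k G n])
qed

text \<open>Each generator matrix is a polynomial multiple of the other, and basicness makes the two
  transition matrices mutually inverse. They are therefore square and unimodular.\<close>

lemma max_minor_degree_generator_unique:
  fixes G G' :: "'a::field poly mat"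
  assumes "generator_matrix C G" "generator_matrix C G'"
  shows "max_minor_degree G = max_minor_degree G'"
proof -
  define k k' n where "k = dim_row G" and "k' = dim_row G'" and "n = dim_col G"
  have eq: "code_image G = code_image G'" using assms by (auto simp: generator_matrix_def)
  have G: "G \<in> carrier_mat k n" and G': "G' \<in> carrier_mat k' n"
    using code_image_dim_col[OF eq] by (auto simp: k_def k'_def n_def)
  obtain H where H: "H \<in> carrier_mat n k" "G * H = 1\<^sub>m k"
    using assms(1) G by (auto simp: generator_matrix_def basic_mat_def)
  obtain H' where H': "H' \<in> carrier_mat n k'" "G' * H' = 1\<^sub>m k'"
    using assms(2) G' by (auto simp: generator_matrix_def basic_mat_def)
  \<comment> \<open>The factorization through a right inverse yields \<open>G = G * H' * G'\<close>
    and \<open>G' = G' * H * G\<close>; the left factors are the transition matrices.\<close>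
  define S T where "S = G * H'" and "T = G' * H"
  have S: "S \<in> carrier_mat k k'" and T: "T \<in> carrier_mat k' k"
    using G G' H H' by (auto simp: S_def T_def)
  have GS: "G = S * G'" and GT: "G' = T * G"
    using code_image_subset_factor[OF G' H' G] code_image_subset_factor[OF G H G'] eq
    by (auto simp: S_def T_def)
  have "S * T = (S * G') * H"
    unfolding T_def using S G' H by (simp add: assoc_mult_mat[of S k k' G' n H k])
  hence ST: "S * T = 1\<^sub>m k" using GS H by simp
  have "T * S = (T * G) * H'"
    unfolding S_def using T G H' by (simp add: assoc_mult_mat[of T k' k G n H' k'])
  hence TS: "T * S = 1\<^sub>m k'" using GT H' by simp
  \<comment> \<open>Only after this are \<open>S\<close> and \<open>T\<close> square, so that
    determinants become available.\<close>
  have kk: "k' = k"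
    using right_inverse_imp_dim_le[OF S T ST] right_inverse_imp_dim_le[OF T S TS] by simp
  have "det T * det S = 1"
    using det_mult[of T k S] S T TS by (simp add: kk)
  hence "det T dvd 1" by (metis dvd_triv_left)
  hence "max_minor_degree (T * G) = max_minor_degree G"
    using T G by (intro max_minor_degree_unimodular) (auto simp: kk)
  thus ?thesis using GT by simp
qed

text \<open>Eliminates the choice in the definition: the chosen matrix generates the same code as
  \<open>G\<close>, and all generator matrices share the maximal minor degree.\<close>

lemma overall_constraint_length_eq:
  assumes "generator_matrix C G"
  shows "overall_constraint_length C = max_minor_degree G"
  unfolding overall_constraint_length_def
  using assms by (intro max_minor_degree_generator_unique[of C]) (rule someI)

section \<open>Monomial matrices\<close>

text \<open>Permutation matrix of \<open>\<sigma>\<close> times the diagonal matrix of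
  \<open>r\<close>: as a right factor it puts \<open>r j\<close> times column
  \<open>\<sigma> j\<close> into position \<open>j\<close>.\<close>

definition monomial_mat :: "nat \<Rightarrow> (nat \<Rightarrow> nat) \<Rightarrow> (nat \<Rightarrow> 'a::zero) \<Rightarrow> 'a mat" where
  "monomial_mat n \<sigma> r = mat n n (\<lambda>(i, j). if i = \<sigma> j then r j else 0)"

lemma monomial_mat_carrier [simp]: "monomial_mat n \<sigma> r \<in> carrier_mat n n"
  by (simp add: monomial_mat_def)

lemma monomial_mat_dim [simp]:
  "dim_row (monomial_mat n \<sigma> r) = n" "dim_col (monomial_mat n \<sigma> r) = n"
  by (simp_all add: monomial_mat_def)

lemma const_poly_mat_monomial:
  "const_poly_mat (monomial_mat n \<sigma> r) = monomial_mat n \<sigma> (\<lambda>j. [:r j:])"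
  by (auto simp: const_poly_mat_def monomial_mat_def)

lemma mult_monomial_mat_index:
  fixes A :: "'a::comm_semiring_1 mat"
  assumes "A \<in> carrier_mat k n" "\<sigma> permutes {..<n}" "i < k" "j < n"
  shows "(A * monomial_mat n \<sigma> r) $$ (i, j) = A $$ (i, \<sigma> j) * r j"
proof -
  have "(A * monomial_mat n \<sigma> r) $$ (i, j) = (\<Sum>l = 0..<n. A $$ (i, l) * (if l = \<sigma> j then r j else 0))"
    using assms by (auto simp: scalar_prod_def monomial_mat_def)
  also have "\<dots> = (\<Sum>l = 0..<n. if l = \<sigma> j then A $$ (i, l) * r j else 0)"
    by (intro sum.cong) auto
  also have "\<dots> = A $$ (i, \<sigma> j) * r j"
    using permutes_in_image[OF assms(2), of j] assms(4) by (simp add: sum.delta)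
  finally show ?thesis .
qed

lemma row_vec_mult_monomial_mat_index:
  fixes v :: "'a::comm_semiring_1 vec"
  assumes "v \<in> carrier_vec n" "\<sigma> permutes {..<n}" "j < n"
  shows "(v \<bullet>\<^sub>r monomial_mat n \<sigma> r) $ j = v $ \<sigma> j * r j"
proof -
  have "(v \<bullet>\<^sub>r monomial_mat n \<sigma> r) $ j = (\<Sum>l = 0..<n. (if l = \<sigma> j then r j else 0) * v $ l)"
    using assms by (auto simp: row_vec_mult_def scalar_prod_def monomial_mat_def)
  also have "\<dots> = (\<Sum>l = 0..<n. if l = \<sigma> j then v $ l * r j else 0)"
    by (intro sum.cong) (auto simp: mult.commute)
  also have "\<dots> = v $ \<sigma> j * r j"
    using permutes_in_image[OF assms(2), of j] assms(3) by (simp add: sum.delta)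
  finally show ?thesis .
qed

text \<open>Column \<open>j\<close> of the second factor has its entry in row
  \<open>inv_into UNIV \<sigma> j\<close>, so it must be the reciprocal of the weight
  \<open>r\<close> at that index rather than at \<open>j\<close>.\<close>

lemma monomial_mat_inverse:
  fixes r :: "nat \<Rightarrow> 'a::field"
  assumes \<sigma>: "\<sigma> permutes {..<n}" and r: "\<And>j. j < n \<Longrightarrow> r j \<noteq> 0"
  shows "monomial_mat n \<sigma> r * monomial_mat n (inv_into UNIV \<sigma>) (\<lambda>j. 1 / r (inv_into UNIV \<sigma> j)) = 1\<^sub>m n"
proof (rule eq_matI)
  fix i j assume "i < dim_row (1\<^sub>m n :: 'a mat)" "j < dim_col (1\<^sub>m n :: 'a mat)"
  hence ij: "i < n" "j < n" by auto
  hence "inv_into UNIV \<sigma> j < n" using permutes_in_image[OF permutes_inv[OF \<sigma>], of j] by simp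
  thus "(monomial_mat n \<sigma> r * monomial_mat n (inv_into UNIV \<sigma>)
      (\<lambda>j. 1 / r (inv_into UNIV \<sigma> j))) $$ (i, j) = 1\<^sub>m n $$ (i, j)"
    using ij r[of "inv_into UNIV \<sigma> j"]
    by (subst mult_monomial_mat_index[OF _ permutes_inv[OF \<sigma>]])
      (auto simp: monomial_mat_def permutes_inverses[OF \<sigma>])
qed (auto simp: monomial_mat_def)

text \<open>Merges the permutation and the diagonal matrix into one monomial matrix and turns
  invertibility into nonvanishing weights.\<close>

lemma monomially_equivalent_matsE:
  fixes G G' :: "'a::field poly mat"
  assumes "monomially_equivalent_mats G G'" "dim_col G = n"
  obtains \<sigma> r where "\<sigma> permutes {..<n}" "\<And>j. j < n \<Longrightarrow> r j \<noteq> 0"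
    "G' = G * const_poly_mat (monomial_mat n \<sigma> r)"
proof -
  obtain P R \<sigma> where \<sigma>: "\<sigma> permutes {..<n}" and P: "P = mat n n (\<lambda>(i, j). if i = \<sigma> j then 1 else 0)"
    and R: "R \<in> carrier_mat n n" "diagonal_mat R" "invertible_mat R"
    and G': "G' = G * const_poly_mat P * const_poly_mat R"
    using assms by (auto simp: monomially_equivalent_mats_def permutation_mat_def)
  \<comment> \<open>Both factors are themselves monomial: one has all weights 1, the other has the
    identity permutation.\<close>
  have PR: "P = monomial_mat n \<sigma> (\<lambda>_. 1)" "R = monomial_mat n id (\<lambda>j. R $$ (j, j))"
    using R by (auto simp: P monomial_mat_def diagonal_mat_def)
  obtain S where S: "R * S = 1\<^sub>m n" "S * R = 1\<^sub>m (dim_row S)"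
    using R by (auto simp: invertible_mat_def inverts_mat_def)
  \<comment> \<open>The size of the inverse is read off from the two products equal to identity
    matrices.\<close>
  have Sc: "S \<in> carrier_mat n n"
    using S R by (metis carrier_matD(2) carrier_matI index_mult_mat(3) index_one_mat(3))
  have "R $$ (j, j) \<noteq> 0" if j: "j < n" for j
  proof
    assume 0: "R $$ (j, j) = 0"
    \<comment> \<open>The diagonal matrix \<open>R\<close> scales the columns of \<open>S\<close>,
      so a zero diagonal entry would leave a zero on the diagonal of the identity.\<close>
    have "(S * R) $$ (j, j) = S $$ (j, j) * R $$ (j, j)"
      using mult_monomial_mat_index[OF Sc permutes_id j j, of "\<lambda>j. R $$ (j, j)"] PR(2) by simp
    thus False using 0 S(2) Sc j by simp
  qed
  moreover have "G' = G * const_poly_mat (monomial_mat n \<sigma> (\<lambda>j. R $$ (j, j)))"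
  proof -
    have "P * R = monomial_mat n \<sigma> (\<lambda>j. R $$ (j, j))"
    proof (rule eq_matI)
      fix i j assume "i < dim_row (monomial_mat n \<sigma> (\<lambda>j. R $$ (j, j)))"
        "j < dim_col (monomial_mat n \<sigma> (\<lambda>j. R $$ (j, j)))"
      hence "i < n" "j < n" by (auto simp: monomial_mat_def)
      thus "(P * R) $$ (i, j) = monomial_mat n \<sigma> (\<lambda>j. R $$ (j, j)) $$ (i, j)"
        by (subst PR(2), subst mult_monomial_mat_index[OF _ permutes_id])
          (auto simp: P monomial_mat_def)
    qed (use R in \<open>auto simp: P monomial_mat_def\<close>)
    hence cM: "const_poly_mat (monomial_mat n \<sigma> (\<lambda>j. R $$ (j, j))) = const_poly_mat P * const_poly_mat R"
      using const_poly_mat_mult[of P n n R n] R(1) P by simp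
    have c: "G \<in> carrier_mat (dim_row G) n" by (rule carrier_matI[OF refl assms(2)])
    have "const_poly_mat P \<in> carrier_mat n n" "const_poly_mat R \<in> carrier_mat n n"
      using R(1) by (simp_all add: P)
    thus ?thesis unfolding G' cM by (rule assoc_mult_mat[OF c])
  qed
  ultimately show ?thesis by (intro that[OF \<sigma>])
qed

text \<open>Position \<open>j\<close> of the new word is a nonzero multiple of position
  \<open>\<sigma> j\<close> of \<open>v\<close>, so \<open>\<sigma>\<close> maps the new support
  bijectively onto the old one.\<close>

lemma hamming_weight_monomial:
  fixes v :: "'a::field vec"
  assumes v: "v \<in> carrier_vec n" and \<sigma>: "\<sigma> permutes {..<n}" and r: "\<And>j. j < n \<Longrightarrow> r j \<noteq> 0"
  shows "hamming_weight (v \<bullet>\<^sub>r monomial_mat n \<sigma> r) = hamming_weight v"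
proof -
  have d: "dim_vec (v \<bullet>\<^sub>r monomial_mat n \<sigma> r) = n"
    by (simp add: row_vec_mult_def monomial_mat_def)
  have "bij_betw \<sigma> {j. j < n \<and> v $ \<sigma> j \<noteq> 0} {j. j < n \<and> v $ j \<noteq> 0}"
  proof (rule bij_betwI[where g = "inv_into UNIV \<sigma>"])
    show "\<sigma> \<in> {j. j < n \<and> v $ \<sigma> j \<noteq> 0} \<rightarrow> {j. j < n \<and> v $ j \<noteq> 0}"
      using permutes_in_image[OF \<sigma>] by auto
    show "inv_into UNIV \<sigma> \<in> {j. j < n \<and> v $ j \<noteq> 0} \<rightarrow> {j. j < n \<and> v $ \<sigma> j \<noteq> 0}"
      using permutes_in_image[OF permutes_inv[OF \<sigma>]] by (auto simp: permutes_inverses[OF \<sigma>])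
  qed (auto simp: permutes_inverses[OF \<sigma>])
  moreover have "{j. j < n \<and> (v \<bullet>\<^sub>r monomial_mat n \<sigma> r) $ j \<noteq> 0} = {j. j < n \<and> v $ \<sigma> j \<noteq> 0}"
    using r by (auto simp: row_vec_mult_monomial_mat_index[OF v \<sigma>])
  ultimately show ?thesis
    using v d by (auto simp: hamming_weight_def dest: bij_betw_same_card)
qed

section \<open>Monomial transformation of a generator matrix\<close>

lemma append_rows_mult:
  fixes A B :: "'a::comm_semiring_1 mat"
  assumes A: "A \<in> carrier_mat m n" and B: "B \<in> carrier_mat m' n" and M: "M \<in> carrier_mat n l"
  shows "(A @\<^sub>r B) * M = A * M @\<^sub>r B * M"
proof (rule eq_matI)
  fix i j assume "i < dim_row (A * M @\<^sub>r B * M)" "j < dim_col (A * M @\<^sub>r B * M)"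
  hence ij: "i < m + m'" "j < l"
    using A B M by (auto simp: append_rows_def)
  have "row (A @\<^sub>r B) i = (if i < m then row A i else row B (i - m))"
    using ij A B by (intro eq_vecI) (auto simp: append_rows_def)
  thus "((A @\<^sub>r B) * M) $$ (i, j) = (A * M @\<^sub>r B * M) $$ (i, j)"
    using ij A B M by (auto simp: append_rows_def)
qed (use A B M in \<open>auto simp: append_rows_def\<close>)

lemma foldr_append_rows_carrier:
  assumes "\<And>i. i \<in> set xs \<Longrightarrow> f i \<in> carrier_mat (d i) n"
  shows "foldr append_rows (map f xs) (0\<^sub>m 0 n) \<in> carrier_mat (sum_list (map d xs)) n"
  using assms by (induction xs) auto

text \<open>Lets a right factor pass through the stacked matrix \<open>ccf_C\<close> block by block;
  the heights \<open>d i\<close> may differ and may be 0.\<close>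

lemma foldr_append_rows_mult:
  fixes f :: "'b \<Rightarrow> 'a::comm_semiring_1 mat"
  assumes "\<And>i. i \<in> set xs \<Longrightarrow> f i \<in> carrier_mat (d i) n" "M \<in> carrier_mat n l"
  shows "foldr append_rows (map f xs) (0\<^sub>m 0 n) * M =
    foldr append_rows (map (\<lambda>i. f i * M) xs) (0\<^sub>m 0 l)"
  using assms
proof (induction xs)
  case Nil
  then show ?case by (intro eq_matI) auto
next
  case (Cons i xs)
  then show ?case
    using append_rows_mult[of "f i" "d i" n _ "sum_list (map d xs)" M l]
      foldr_append_rows_carrier[of xs f d n] by simp
qed

text \<open>The data of an invertible monomial matrix. As a locale it can be instantiated again at
  the inverse matrix, which turns one-sided statements into two-sided ones.\<close>

locale monomial_transform =
  fixes n :: nat and \<sigma> :: "nat \<Rightarrow> nat" and r :: "nat \<Rightarrow> 'a::field"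
  assumes perm: "\<sigma> permutes {..<n}" and nonzero: "\<And>j. j < n \<Longrightarrow> r j \<noteq> 0"
begin

abbreviation M :: "'a poly mat" where "M \<equiv> const_poly_mat (monomial_mat n \<sigma> r)"

abbreviation M_inv :: "'a poly mat" where
  "M_inv \<equiv> const_poly_mat (monomial_mat n (inv_into UNIV \<sigma>) (\<lambda>j. 1 / r (inv_into UNIV \<sigma> j)))"

lemma inverse_transform: "monomial_transform n (inv_into UNIV \<sigma>) (\<lambda>j. 1 / r (inv_into UNIV \<sigma> j))"
proof
  show "inv_into UNIV \<sigma> permutes {..<n}" by (rule permutes_inv[OF perm])
  show "1 / r (inv_into UNIV \<sigma> j) \<noteq> 0" if "j < n" for j
    using nonzero[of "inv_into UNIV \<sigma> j"] permutes_in_image[OF permutes_inv[OF perm], of j] that by simp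
qed

lemma perm_lt: "j < n \<Longrightarrow> \<sigma> j < n"
  using permutes_in_image[OF perm, of j] by simp

lemma M_mult_M_inv: "M * M_inv = 1\<^sub>m n"
proof -
  have "M * M_inv = const_poly_mat (monomial_mat n \<sigma> r *
      monomial_mat n (inv_into UNIV \<sigma>) (\<lambda>j. 1 / r (inv_into UNIV \<sigma> j)))"
    by (rule const_poly_mat_mult[symmetric, where m = n and k = n and n = n]) simp_all
  also have "\<dots> = const_poly_mat (1\<^sub>m n)" using monomial_mat_inverse[OF perm, of r] nonzero by simp
  also have "\<dots> = 1\<^sub>m n" by (rule const_poly_mat_one)
  finally show ?thesis .
qed

lemma mult_M_M_inv: "G \<in> carrier_mat k n \<Longrightarrow> G * M * M_inv = G"
  by (simp add: assoc_mult_mat[of G k n M n M_inv n] M_mult_M_inv)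

lemma mult_M_index:
  "G \<in> carrier_mat k n \<Longrightarrow> i < k \<Longrightarrow> j < n \<Longrightarrow> (G * M) $$ (i, j) = smult (r j) (G $$ (i, \<sigma> j))"
  unfolding const_poly_mat_monomial by (subst mult_monomial_mat_index[OF _ perm]) auto

text \<open>Row \<open>i\<close> is only permuted and rescaled by nonzero constants, so even the set
  of degrees of its entries stays the same.\<close>

lemma row_degree_mult_M:
  assumes G: "G \<in> carrier_mat k n" and i: "i < k"
  shows "row_degree (G * M) i = row_degree G i"
proof -
  have "{degree ((G * M) $$ (i, j)) | j. j < n} = (\<lambda>j. degree ((G * M) $$ (i, j))) ` {..<n}"
    by auto
  also have "\<dots> = (\<lambda>j. degree (G $$ (i, \<sigma> j))) ` {..<n}"
    using nonzero by (intro image_cong) (auto simp: mult_M_index[OF G i])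
  also have "\<dots> = (\<lambda>j. degree (G $$ (i, j))) ` (\<sigma> ` {..<n})" by (simp add: image_image)
  also have "\<sigma> ` {..<n} = {..<n}" by (rule permutes_image[OF perm])
  also have "(\<lambda>j. degree (G $$ (i, j))) ` {..<n} = {degree (G $$ (i, j)) | j. j < n}" by auto
  finally show ?thesis using G by (simp add: row_degree_def const_poly_mat_def monomial_mat_def)
qed

lemma mult_M_carrier: "G \<in> carrier_mat k n \<Longrightarrow> G * M \<in> carrier_mat k n"
  by simp

section \<open>Controller canonical form under the transformation\<close>

lemma total_row_degree_mult_M:
  assumes G: "G \<in> carrier_mat k n"
  shows "total_row_degree (G * M) = total_row_degree G"
  using G row_degree_mult_M[OF G] by (simp add: total_row_degree_def)

text \<open>The blocks are determined by the row degrees alone; the same reason applies to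
  \<open>ccf_B\<close>.\<close>

lemma ccf_A_mult_M:
  assumes G: "G \<in> carrier_mat k n"
  shows "ccf_A (G * M) = ccf_A G"
  unfolding ccf_A_def using G
  by (intro arg_cong[where f = diag_block_mat] map_cong) (auto simp: row_degree_mult_M[OF G])

lemma ccf_B_mult_M:
  assumes G: "G \<in> carrier_mat k n"
  shows "ccf_B (G * M) = ccf_B G"
  unfolding ccf_B_def using G
  by (intro arg_cong[where f = diag_block_mat] map_cong) (auto simp: row_degree_mult_M[OF G])

lemma ccf_D_mult_M:
  assumes G: "G \<in> carrier_mat k n"
  shows "ccf_D (G * M) = ccf_D G * monomial_mat n \<sigma> r"
proof (rule eq_matI)
  have D: "ccf_D G \<in> carrier_mat k n" using G by (simp add: ccf_D_def)
  fix i j assume "i < dim_row (ccf_D G * monomial_mat n \<sigma> r)" "j < dim_col (ccf_D G * monomial_mat n \<sigma> r)"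
  hence ij: "i < k" "j < n" using D by (auto simp: monomial_mat_def)
  thus "ccf_D (G * M) $$ (i, j) = (ccf_D G * monomial_mat n \<sigma> r) $$ (i, j)"
    unfolding mult_monomial_mat_index[OF D perm ij]
    using G mult_M_carrier[OF G] perm_lt[of j] mult_M_index[OF G ij] by (simp add: ccf_D_def)
qed (use G in \<open>auto simp: ccf_D_def const_poly_mat_def monomial_mat_def\<close>)

lemma ccf_C_carrier:
  assumes G: "G \<in> carrier_mat k n"
  shows "ccf_C G \<in> carrier_mat (total_row_degree G) n"
proof -
  have "total_row_degree G = sum_list (map (row_degree G) [0..<dim_row G])"
    by (simp add: total_row_degree_def atLeast0LessThan flip: sum_set_upt_conv_sum_list_nat)
  thus ?thesis
    unfolding ccf_C_def using G by (auto intro!: foldr_append_rows_carrier)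
qed

text \<open>Extracting a coefficient commutes with permuting and rescaling columns, and unchanged
  row degrees keep the block heights.\<close>

lemma ccf_C_mult_M:
  assumes G: "G \<in> carrier_mat k n"
  shows "ccf_C (G * M) = ccf_C G * monomial_mat n \<sigma> r"
proof -
  \<comment> \<open>The block of row \<open>i\<close>: its row \<open>\<nu>\<close>, counted from 0,
    holds the coefficients of exponent \<open>\<nu> + 1\<close>, as the constant terms go into
    \<open>ccf_D\<close>.\<close>
  let ?c = "\<lambda>G i. mat (row_degree G i) n (\<lambda>(\<nu>, j). coeff (G $$ (i, j)) (\<nu> + 1))"
  have "?c (G * M) i = ?c G i * monomial_mat n \<sigma> r" if i: "i < k" for i
  proof (rule eq_matI)
    fix \<nu> j assume "\<nu> < dim_row (?c G i * monomial_mat n \<sigma> r)" "j < dim_col (?c G i * monomial_mat n \<sigma> r)"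
    hence \<nu>: "\<nu> < row_degree G i" and j: "j < n" by (auto simp: monomial_mat_def)
    show "?c (G * M) i $$ (\<nu>, j) = (?c G i * monomial_mat n \<sigma> r) $$ (\<nu>, j)"
      using \<nu> j perm_lt[OF j] mult_M_index[OF G i j]
      by (subst mult_monomial_mat_index[OF _ perm, where k = "row_degree G i"])
        (auto simp: row_degree_mult_M[OF G i])
  qed (auto simp: row_degree_mult_M[OF G i])
  hence map_eq: "map (?c (G * M)) [0..<k] = map (\<lambda>i. ?c G i * monomial_mat n \<sigma> r) [0..<k]"
    by (intro map_cong) auto
  have C: "ccf_C H = foldr append_rows (map (?c H) [0..<k]) (0\<^sub>m 0 n)" if "H \<in> carrier_mat k n" for H
    using that by (simp add: ccf_C_def)
  show ?thesis
    unfolding C[OF mult_M_carrier[OF G]] C[OF G] map_eq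
    by (rule foldr_append_rows_mult[symmetric, where d = "row_degree G" and n = n]) auto
qed

text \<open>By linearity the new output is the old one times the monomial matrix, which preserves
  the weight.\<close>

lemma output_weight_mult_M:
  assumes G: "G \<in> carrier_mat k n"
    and x: "x \<in> carrier_vec (total_row_degree G)" and u: "u \<in> carrier_vec k"
  shows "hamming_weight (x \<bullet>\<^sub>r ccf_C (G * M) + u \<bullet>\<^sub>r ccf_D (G * M)) =
         hamming_weight (x \<bullet>\<^sub>r ccf_C G + u \<bullet>\<^sub>r ccf_D G)"
proof -
  have D: "ccf_D G \<in> carrier_mat k n" using G by (simp add: ccf_D_def)
  note C = ccf_C_carrier[OF G]
  have "x \<bullet>\<^sub>r ccf_C (G * M) + u \<bullet>\<^sub>r ccf_D (G * M) =
        x \<bullet>\<^sub>r ccf_C G \<bullet>\<^sub>r monomial_mat n \<sigma> r + u \<bullet>\<^sub>r ccf_D G \<bullet>\<^sub>r monomial_mat n \<sigma> r"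
    using row_vec_mult_assoc[OF x C monomial_mat_carrier] row_vec_mult_assoc[OF u D monomial_mat_carrier]
    by (simp add: ccf_C_mult_M[OF G] ccf_D_mult_M[OF G])
  also have "\<dots> = (x \<bullet>\<^sub>r ccf_C G + u \<bullet>\<^sub>r ccf_D G) \<bullet>\<^sub>r monomial_mat n \<sigma> r"
    using C D by (intro row_vec_mult_add_left[symmetric, where n = n and m = n]) auto
  finally show ?thesis
    using C D hamming_weight_monomial[OF _ perm nonzero, of "x \<bullet>\<^sub>r ccf_C G + u \<bullet>\<^sub>r ccf_D G"] by simp
qed

section \<open>Basicness, code and minors under the transformation\<close>

lemma basic_mat_mult_M:
  assumes G: "G \<in> carrier_mat k n" and basic: "basic_mat G"
  shows "basic_mat (G * M)"
proof -
  obtain H where H: "H \<in> carrier_mat n k" "G * H = 1\<^sub>m k"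
    using basic G by (auto simp: basic_mat_def)
  \<comment> \<open>Undoing \<open>M\<close> first and then applying the right inverse
    \<open>H\<close> of \<open>G\<close> gives a right inverse of \<open>G * M\<close>.\<close>
  have "(G * M) * (M_inv * H) = G * M * M_inv * H"
    using G H by (simp add: assoc_mult_mat[of "G * M" k n M_inv n H k])
  also have "\<dots> = 1\<^sub>m k" using H by (simp add: mult_M_M_inv[OF G])
  finally show ?thesis
    using G mult_M_carrier[OF G] H unfolding basic_mat_def
    by (intro bexI[of _ "M_inv * H"]) auto
qed

text \<open>Writing the new code as an image of the old code, not of a matrix, allows a later
  exchange of the generator matrix.\<close>

lemma code_image_mult_M:
  assumes G: "G \<in> carrier_mat k n"
  shows "code_image (G * M) = (\<lambda>w. w \<bullet>\<^sub>r laurent_mat M) ` code_image G"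
proof -
  have "u \<bullet>\<^sub>r laurent_mat (G * M) = u \<bullet>\<^sub>r laurent_mat G \<bullet>\<^sub>r laurent_mat M"
    if "u \<in> carrier_vec k" for u
    using that G row_vec_mult_assoc[of u k "laurent_mat G" n "laurent_mat M" n]
    by (simp add: laurent_mat_mult[OF G, of M n])
  hence eq: "(\<lambda>u. u \<bullet>\<^sub>r laurent_mat (G * M)) ` carrier_vec k =
      (\<lambda>u. u \<bullet>\<^sub>r laurent_mat G \<bullet>\<^sub>r laurent_mat M) ` carrier_vec k"
    by (intro image_cong refl)
  have "code_image H = (\<lambda>u. u \<bullet>\<^sub>r laurent_mat H) ` carrier_vec k" if "H \<in> carrier_mat k n" for H
    using that by (auto simp: code_image_def)
  from this[OF G] this[OF mult_M_carrier[OF G]] show ?thesis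
    by (simp only: image_image eq)
qed

text \<open>The \<open>J\<close>-minor of \<open>G M\<close> is the \<open>\<sigma> J\<close>-minor of \<open>G\<close> up to a constant factor.\<close>

lemma degree_minor_mult_M_le:
  assumes G: "G \<in> carrier_mat k n" and J: "J \<subseteq> {..<n}" "card J = k"
  shows "degree (det (submatrix (G * M) UNIV J)) \<le> degree (det (submatrix G UNIV (\<sigma> ` J)))"
proof -
  \<comment> \<open>\<open>pick\<close> lists a set in increasing order, an order that
    \<open>\<sigma>\<close> may destroy. The constant matrix \<open>N\<close> restores the order of
    the columns and carries their weights.\<close>
  define N where "N = mat k k (\<lambda>(i, j). if pick (\<sigma> ` J) i = \<sigma> (pick J j) then r (pick J j) else 0)"
  have N: "const_poly_mat N \<in> carrier_mat k k" by (simp add: N_def)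
  have J': "\<sigma> ` J \<subseteq> {..<n}" "card (\<sigma> ` J) = k"
    using J perm_lt permutes_inj_on[OF perm, of J] by (auto simp: card_image)
  have S: "submatrix G UNIV (\<sigma> ` J) \<in> carrier_mat k k"
    using submatrix_cols_carrier[OF G J'(1)] J'(2) by simp
  have S': "submatrix (G * M) UNIV J \<in> carrier_mat k k"
    using submatrix_cols_carrier[OF mult_M_carrier[OF G] J(1)] J(2) by simp
  have "submatrix (G * M) UNIV J = submatrix G UNIV (\<sigma> ` J) * const_poly_mat N"
  proof (rule eq_matI)
    fix i j assume "i < dim_row (submatrix G UNIV (\<sigma> ` J) * const_poly_mat N)"
      "j < dim_col (submatrix G UNIV (\<sigma> ` J) * const_poly_mat N)"
    hence ij: "i < k" "j < k" using S N by auto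
    \<comment> \<open>The position of \<open>\<sigma> (pick J j)\<close> in the increasing list of
      the image set is the number of smaller elements; column \<open>j\<close> of \<open>N\<close>
      has its entry there.\<close>
    define b where "b = card {a \<in> \<sigma> ` J. a < \<sigma> (pick J j)}"
    have mem: "\<sigma> (pick J j) \<in> \<sigma> ` J" using pick_in_set_le ij J by auto
    have pb: "pick (\<sigma> ` J) b = \<sigma> (pick J j)"
      unfolding b_def by (rule pick_card_in_set[OF mem])
    have fin: "finite (\<sigma> ` J)" using J'(1) finite_subset by blast
    have "{a \<in> \<sigma> ` J. a < \<sigma> (pick J j)} \<subset> \<sigma> ` J" using mem by auto
    hence b: "b < k" unfolding b_def using psubset_card_mono[OF fin] J'(2) by metis
    have uniq: "l = b" if "l < k" "pick (\<sigma> ` J) l = \<sigma> (pick J j)" for l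
      using that card_pick_le[of l "\<sigma> ` J"] J'(2) by (simp add: b_def)
    have pj: "pick J j < n" using pick_lessThan[OF J(1)] ij J(2) by simp
    have "(submatrix G UNIV (\<sigma> ` J) * const_poly_mat N) $$ (i, j) =
        (\<Sum>l = 0..<k. submatrix G UNIV (\<sigma> ` J) $$ (i, l) * const_poly_mat N $$ (l, j))"
      by (rule mult_mat_index_sum[OF S N ij])
    also have "\<dots> = (\<Sum>l = 0..<k. if l = b then smult (r (pick J j)) (G $$ (i, \<sigma> (pick J j))) else 0)"
    proof (rule sum.cong[OF refl])
      fix l assume "l \<in> {0..<k}"
      hence l: "l < k" by simp
      have "submatrix G UNIV (\<sigma> ` J) $$ (i, l) = G $$ (i, pick (\<sigma> ` J) l)"
        using submatrix_cols_index[OF G J'(1) ij(1)] l J'(2) by metis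
      moreover have "const_poly_mat N $$ (l, j) =
          (if pick (\<sigma> ` J) l = \<sigma> (pick J j) then [:r (pick J j):] else 0)"
        using l ij(2) by (simp add: N_def const_poly_mat_def)
      moreover have "pick (\<sigma> ` J) l = \<sigma> (pick J j) \<longleftrightarrow> l = b" using uniq[OF l] pb by metis
      ultimately show "submatrix G UNIV (\<sigma> ` J) $$ (i, l) * const_poly_mat N $$ (l, j) =
          (if l = b then smult (r (pick J j)) (G $$ (i, \<sigma> (pick J j))) else 0)"
        by (cases "l = b") simp_all
    qed
    also have "\<dots> = smult (r (pick J j)) (G $$ (i, \<sigma> (pick J j)))"
      using b by (simp add: sum.delta)
    also have "\<dots> = submatrix (G * M) UNIV J $$ (i, j)"
      using submatrix_cols_index[OF mult_M_carrier[OF G] J(1) ij(1), of j] ij(2) J(2)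
      by (simp only: mult_M_index[OF G ij(1) pj])
    finally show "submatrix (G * M) UNIV J $$ (i, j) =
      (submatrix G UNIV (\<sigma> ` J) * const_poly_mat N) $$ (i, j)" by simp
  qed (use S S' N in auto)
  hence "det (submatrix (G * M) UNIV J) = det (submatrix G UNIV (\<sigma> ` J)) * det (const_poly_mat N)"
    using det_mult[OF S N] by simp
  \<comment> \<open>The upper bound holds even if the determinant of \<open>N\<close> vanishes;
    equality will come from the same bound for the inverse transformation.\<close>
  thus ?thesis
    using degree_mult_le[of "det (submatrix G UNIV (\<sigma> ` J))" "det (const_poly_mat N)"]
    by (simp add: degree_det_const_poly_mat)
qed

end

section \<open>Invariance of minor degrees and of minimality\<close>

context monomial_transform
begin

interpretation inverse: monomial_transform n "inv_into UNIV \<sigma>" "\<lambda>j. 1 / r (inv_into UNIV \<sigma> j)"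
  by (rule inverse_transform)

text \<open>\<open>\<sigma>\<close> permutes the \<open>k\<close>-subsets of the columns, and
  corresponding minors have equal degrees by the bounds for \<open>M\<close> and for its
  inverse.\<close>

lemma minor_degrees_mult_M:
  assumes G: "G \<in> carrier_mat k n"
  shows "{degree (det (submatrix (G * M) UNIV J)) | J. J \<subseteq> {..<n} \<and> card J = k} =
         {degree (det (submatrix G UNIV J)) | J. J \<subseteq> {..<n} \<and> card J = k}"
proof -
  let ?J = "{J. J \<subseteq> {..<n} \<and> card J = k}"
  have img: "\<sigma> ` J \<subseteq> {..<n}" "card (\<sigma> ` J) = k" "inv_into UNIV \<sigma> ` (\<sigma> ` J) = J"
    if "J \<subseteq> {..<n}" "card J = k" for J
    using that perm_lt permutes_inj_on[OF perm, of J]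
    by (auto simp: card_image image_image permutes_inverses[OF perm])
  have img': "inv_into UNIV \<sigma> ` J \<subseteq> {..<n}" "card (inv_into UNIV \<sigma> ` J) = k"
    if "J \<subseteq> {..<n}" "card J = k" for J
    using that inverse.perm_lt permutes_inj_on[OF inverse.perm, of J] by (auto simp: card_image)
  have eq: "degree (det (submatrix (G * M) UNIV J)) = degree (det (submatrix G UNIV (\<sigma> ` J)))"
    if J: "J \<in> ?J" for J
  proof (rule antisym)
    have J': "J \<subseteq> {..<n}" "card J = k" using J by auto
    show "degree (det (submatrix (G * M) UNIV J)) \<le> degree (det (submatrix G UNIV (\<sigma> ` J)))"
      by (rule degree_minor_mult_M_le[OF G J'])
    \<comment> \<open>The bound for the inverse, applied to \<open>G * M\<close> and the image of
      \<open>J\<close>, leads back to \<open>G\<close> and \<open>J\<close> and thus reverses the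
      inequality.\<close>
    show "degree (det (submatrix G UNIV (\<sigma> ` J))) \<le> degree (det (submatrix (G * M) UNIV J))"
      using inverse.degree_minor_mult_M_le[OF mult_M_carrier[OF G] img(1,2)[OF J']]
      unfolding img(3)[OF J'] mult_M_M_inv[OF G] .
  qed
  have "J \<in> (`) \<sigma> ` ?J" if "J \<in> ?J" for J
  proof (rule image_eqI)
    show "J = \<sigma> ` (inv_into UNIV \<sigma> ` J)"
      by (simp add: image_image permutes_inverses[OF perm])
    show "inv_into UNIV \<sigma> ` J \<in> ?J" using img' that by simp
  qed
  moreover have "(`) \<sigma> ` ?J \<subseteq> ?J" using img(1,2) by blast
  ultimately have "(`) \<sigma> ` ?J = ?J" by blast
  moreover have "(\<lambda>J. degree (det (submatrix (G * M) UNIV J))) ` ?J =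
      (\<lambda>J. degree (det (submatrix G UNIV J))) ` ((`) \<sigma> ` ?J)"
    unfolding image_image by (rule image_cong[OF refl eq])
  ultimately show ?thesis
    by (simp only: setcompr_eq_image)
qed

lemma max_minor_degree_mult_M:
  assumes G: "G \<in> carrier_mat k n"
  shows "max_minor_degree (G * M) = max_minor_degree G"
  using minor_degrees_mult_M[OF G] G mult_M_carrier[OF G] by (simp add: max_minor_degree_def)

text \<open>The pair \<open>G\<close>, \<open>G * M\<close> fixes the transformation between the
  codes; the same \<open>M\<close> then serves every minimal \<open>G1\<close>, since total row
  degree and maximal minor degree are both invariant.\<close>

lemma minimal_generator_matrix_mult_M:
  assumes G: "G \<in> carrier_mat k n" "generator_matrix C G" "generator_matrix C' (G * M)"
    and G1: "minimal_generator_matrix C G1"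
  shows "G1 \<in> carrier_mat (dim_row G1) n" "minimal_generator_matrix C' (G1 * M)"
proof -
  have gen: "basic_mat G1" "C = code_image G1"
    using G1 by (auto simp: minimal_generator_matrix_def generator_matrix_def)
  show c: "G1 \<in> carrier_mat (dim_row G1) n"
    using code_image_dim_col[of G1 G] gen(2) G(1,2)
    by (intro carrier_matI) (simp_all add: generator_matrix_def)
  have gen': "generator_matrix C' (G1 * M)"
  proof -
    have "C' = (\<lambda>w. w \<bullet>\<^sub>r laurent_mat M) ` code_image G"
      using G(3) code_image_mult_M[OF G(1)] by (simp add: generator_matrix_def)
    also have "code_image G = code_image G1" using G(2) gen(2) by (simp add: generator_matrix_def)
    also have "(\<lambda>w. w \<bullet>\<^sub>r laurent_mat M) ` \<dots> = code_image (G1 * M)"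
      by (rule code_image_mult_M[OF c, symmetric])
    finally show ?thesis
      using basic_mat_mult_M[OF c gen(1)] by (simp add: generator_matrix_def)
  qed
  have "overall_constraint_length C' = overall_constraint_length C"
    using overall_constraint_length_eq[OF gen'] overall_constraint_length_eq[of C G1] G1
      max_minor_degree_mult_M[OF c] by (simp add: minimal_generator_matrix_def)
  thus "minimal_generator_matrix C' (G1 * M)"
    using gen' G1 total_row_degree_mult_M[OF c] by (simp add: minimal_generator_matrix_def)
qed

end

section \<open>Literal equality of the adjacency matrices\<close>

lemma adjacency_matrix_mult_monomial:
  fixes r :: "nat \<Rightarrow> 'a::{field,finite}"
  assumes "monomial_transform n \<sigma> r" and G: "G \<in> carrier_mat k n" and X: "state_ordering G X"
  defines "G' \<equiv> G * const_poly_mat (monomial_mat n \<sigma> r)"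
  shows "state_ordering G' X" "adjacency_matrix G' X = adjacency_matrix G X"
proof -
  interpret monomial_transform n \<sigma> r by fact
  have d: "dim_row G' = k" "dim_col G' = n" "dim_row G = k" "dim_col G = n"
    using G mult_M_carrier[OF G] by (auto simp: G'_def)
  have num: "num_states G' = num_states G"
    using total_row_degree_mult_M[OF G] by (simp add: num_states_def G'_def)
  show "state_ordering G' X"
    using X num total_row_degree_mult_M[OF G] by (simp add: state_ordering_def G'_def)
  \<comment> \<open>The bound on \<open>i\<close> makes \<open>X i\<close> a genuine state, as the
    weight invariance requires. The sets of admissible inputs then coincide.\<close>
  have "transition_count G' X i j \<alpha> = transition_count G X i j \<alpha>" if i: "i < num_states G" for i j \<alpha>
  proof -
    have "X i \<in> carrier_vec (total_row_degree G)"
      using X i by (auto simp: state_ordering_def dest: bij_betwE)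
    hence "{u \<in> carrier_vec k. X j = X i \<bullet>\<^sub>r ccf_A G' + u \<bullet>\<^sub>r ccf_B G' \<and>
             hamming_weight (X i \<bullet>\<^sub>r ccf_C G' + u \<bullet>\<^sub>r ccf_D G') = \<alpha>} =
           {u \<in> carrier_vec k. X j = X i \<bullet>\<^sub>r ccf_A G + u \<bullet>\<^sub>r ccf_B G \<and>
             hamming_weight (X i \<bullet>\<^sub>r ccf_C G + u \<bullet>\<^sub>r ccf_D G) = \<alpha>}"
      unfolding G'_def using output_weight_mult_M[OF G]
      by (auto simp: ccf_A_mult_M[OF G] ccf_B_mult_M[OF G])
    thus ?thesis by (simp add: transition_count_def d)
  qed
  thus "adjacency_matrix G' X = adjacency_matrix G X"
    by (auto simp: adjacency_matrix_def num d intro!: eq_matI)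
qed

theorem theorem4p3:
  fixes C C' :: "'a::{field,finite} fls vec set" and n :: nat
  assumes "convolutional_code n C" and "convolutional_code n C'"
    and "overall_constraint_length C > 0" and "overall_constraint_length C' > 0"
    and "monomially_equivalent_codes C C'"
  shows "generalized_adjacency_matrix C = generalized_adjacency_matrix C'"
proof -
  obtain G G' where G: "generator_matrix C G" "generator_matrix C' G'"
    "monomially_equivalent_mats G G'"
    using assms(5) by (auto simp: monomially_equivalent_codes_def)
  define m where "m = dim_col G"
  have Gc: "G \<in> carrier_mat (dim_row G) m" by (rule carrier_matI[OF refl m_def[symmetric]])
  obtain \<sigma> and r :: "nat \<Rightarrow> 'a" where \<sigma>: "\<sigma> permutes {..<m}" "\<And>j. j < m \<Longrightarrow> r j \<noteq> 0"
    and G': "G' = G * const_poly_mat (monomial_mat m \<sigma> r)"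
    using monomially_equivalent_matsE[OF G(3), of m] m_def by blast
  interpret monomial_transform m \<sigma> r by unfold_locales (use \<sigma> in auto)
  interpret inverse: monomial_transform m "inv_into UNIV \<sigma>" "\<lambda>j. 1 / r (inv_into UNIV \<sigma> j)"
    by (rule inverse_transform)
  \<comment> \<open>The predicate under the choice operator in
    \<open>generalized_adjacency_matrix\<close>.\<close>
  let ?orbits = "\<lambda>C L. \<exists>G X. minimal_generator_matrix C G \<and> state_ordering G X \<and>
     L = permutation_orbit (adjacency_matrix G X)"
  have "?orbits C' L" if "?orbits C L" for L
  proof -
    from that obtain G1 X where *: "minimal_generator_matrix C G1" "state_ordering G1 X"
      "L = permutation_orbit (adjacency_matrix G1 X)" by blast
    note G1 = minimal_generator_matrix_mult_M[OF Gc G(1) G(2)[unfolded G'] *(1)]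
    note G1X = adjacency_matrix_mult_monomial[OF monomial_transform_axioms G1(1) *(2)]
    have "L = permutation_orbit (adjacency_matrix (G1 * M) X)"
      unfolding G1X(2) by (rule *(3))
    thus ?thesis using G1(2) G1X(1) by blast
  qed
  moreover have "?orbits C L" if "?orbits C' L" for L
  proof -
    from that obtain G1 X where *: "minimal_generator_matrix C' G1" "state_ordering G1 X"
      "L = permutation_orbit (adjacency_matrix G1 X)" by blast
    \<comment> \<open>Presents \<open>C\<close> as generated by the inverse transform of a generator
      matrix of \<open>C'\<close>, so that the previous argument applies with the codes
      exchanged.\<close>
    have "generator_matrix C (G * M * M_inv)" using G(1) by (simp only: mult_M_M_inv[OF Gc])
    note G1 = inverse.minimal_generator_matrix_mult_M
      [OF mult_M_carrier[OF Gc] G(2)[unfolded G'] this *(1)]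
    note G1X = adjacency_matrix_mult_monomial[OF inverse_transform G1(1) *(2)]
    have "L = permutation_orbit (adjacency_matrix (G1 * M_inv) X)"
      unfolding G1X(2) by (rule *(3))
    thus ?thesis using G1(2) G1X(1) by blast
  qed
  \<comment> \<open>Equal predicates make the choice operator return the same orbit.\<close>
  ultimately have "?orbits C = ?orbits C'" by (intro ext iffI)
  thus ?thesis unfolding generalized_adjacency_matrix_def by (rule arg_cong[where f = Eps])
qed

end
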